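(* Let $n,N\ge 2$ and $\varepsilon\ge 1$ be integers with $\varepsilon/n\le 1/2$, let $\alpha<h(\varepsilon/n)$, and suppose $$N\le 2+2^{-\varepsilon}\left(\frac{1-\varepsilon/n}{\varepsilon/n}\right)^{\lceil\frac{\varepsilon+1}{2}\rceil}\left(\frac{1}{\sqrt{8\varepsilon(1-\varepsilon/n)}}-2^{-n\alpha}\right).$$ Let $v_1,\dots,v_N$ be independent uniform templates in $\mathbb{Z}_2^n$, let $W_0$ be the event that $d_{\mathcal H}(v_i,v_j)\le\varepsilon$ for some $i\ne j$, and for each $k$ let $v_k'$ be uniform in $\mathbb{Z}_2^n$ independent of everything else and $p_k=\mathbb{P}\left(v_k'\in\bigcup_{j\ne k}B_\varepsilon(v_j)\,\middle|\,\overline{W_0}\right)$. Let $p_w=1-\prod_{k=1}^N(1-p_k)$ and $m_{in}=\left\lceil\frac{-\ln 2}{\ln(1-p_w)}\right\rceil$ be the median number of rounds until at least one of the users successfully impersonates another one. Then $$m_{in}=\Omega\left(2^{n(1-h(\varepsilon/n))-3\log_2(N)}\right)\quad\text{and}\quad m_{in}=O\left(2^{n(1-h(\varepsilon/n)+\alpha)-2\log_2(N)}\right).$$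
   Context: Templates lie in $\mathbb{Z}_2^n$ with Hamming distance $d_{\mathcal H}$; $B_\varepsilon(t)=\{y: d_{\mathcal H}(t,y)\le\varepsilon\}$. Insider scenario: all $N$ enrolled users are attackers; in each round every user $k$ draws a fresh uniform template $v_k'$ and tries to match another user's enrolled template (within distance $\varepsilon$); rounds are independent. $h(x)=-x\log_2x-(1-x)\log_2(1-x)$ is the binary entropy function. *)

theory Defs
  imports "HOL-Probability.Probability"
begin

definition bin_entropy :: "real \<Rightarrow> real" where
  "bin_entropy x = - x * log 2 x - (1 - x) * log 2 (1 - x)"

definition templates :: "nat \<Rightarrow> bool list set" where
  "templates n = {xs. length xs = n}"

definition hamming :: "bool list \<Rightarrow> bool list \<Rightarrow> nat" where
  "hamming x y = card {i. i < length x \<and> x ! i \<noteq> y ! i}"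

definition hball :: "nat \<Rightarrow> nat \<Rightarrow> bool list \<Rightarrow> bool list set" where
  "hball n eps t = {y \<in> templates n. hamming t y \<le> eps}"

definition profiles :: "nat \<Rightarrow> nat \<Rightarrow> (nat \<Rightarrow> bool list) set" where
  "profiles n N = PiE {1..N} (\<lambda>_. templates n)"

definition W0 :: "nat \<Rightarrow> nat \<Rightarrow> nat \<Rightarrow> (nat \<Rightarrow> bool list) set" where
  "W0 n N eps = {v \<in> profiles n N. \<exists>i\<in>{1..N}. \<exists>j\<in>{1..N}. i \<noteq> j \<and> hamming (v i) (v j) \<le> eps}"

text \<open>Uniform joint distribution of (v_1..v_N) and a fresh template v'_k.\<close>
definition sample_space :: "nat \<Rightarrow> nat \<Rightarrow> ((nat \<Rightarrow> bool list) \<times> bool list) pmf" where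
  "sample_space n N = pmf_of_set (profiles n N \<times> templates n)"

definition cond_prob_pmf :: "'a pmf \<Rightarrow> 'a set \<Rightarrow> 'a set \<Rightarrow> real" where
  "cond_prob_pmf M A B = measure_pmf.prob M (A \<inter> B) / measure_pmf.prob M B"

definition p_user :: "nat \<Rightarrow> nat \<Rightarrow> nat \<Rightarrow> nat \<Rightarrow> real" where
  "p_user n N eps k = cond_prob_pmf (sample_space n N)
     {(v, w). w \<in> (\<Union>j\<in>{1..N} - {k}. hball n eps (v j))}
     {(v, w). v \<notin> W0 n N eps}"

definition p_w :: "nat \<Rightarrow> nat \<Rightarrow> nat \<Rightarrow> real" where
  "p_w n N eps = 1 - (\<Prod>k=1..N. (1 - p_user n N eps k))"

definition m_in :: "nat \<Rightarrow> nat \<Rightarrow> nat \<Rightarrow> int" where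
  "m_in n N eps = \<lceil>- ln 2 / ln (1 - p_w n N eps)\<rceil>"

end

theory Submission
  imports Defs
begin

text \<open>
  Write \<open>x = \<epsilon>/n\<close>, \<open>\<mu> = x/(1 - x)\<close>, \<open>H = 2^(n h(x)) = \<mu>^(-\<epsilon>) (1 + \<mu>)^n\<close> and
  \<open>s = 1 / sqrt (8 \<epsilon> (1 - x))\<close>. A ball of radius \<open>\<epsilon>\<close> has between \<open>s H\<close> and \<open>H\<close> points, and two
  balls whose centres are more than \<open>\<epsilon>\<close> apart share at most
  \<open>2 H 2^\<epsilon> \<mu>^\<lceil>(\<epsilon>+1)/2\<rceil>\<close> points: weight each word \<open>y\<close> by \<open>\<mu>\<close> to the larger of its two
  distances. The bound on \<open>N\<close> and the second Bonferroni inequality, whose factor \<open>1/2\<close>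
  absorbs the factor \<open>2\<close> just met, show that given no collision the union of \<open>N - 1\<close> balls has
  between \<open>(N - 1) H 2^(-n\<alpha>)\<close> and \<open>(N - 1) H\<close> points. This bounds \<open>- ln (1 - p\<^sub>w)\<close> from
  both sides.

  Two facts about the range of \<open>N\<close> remain. First, \<open>N - 1\<close> balls never cover the space: this
  makes the conditioning event non-null (choose templates greedily) and \<open>p\<^sub>w < 1\<close>; otherwise
  \<open>m\<^sub>i\<^sub>n\<close> would be the junk value \<open>0\<close>. Secondly, \<open>N\<^sup>2\<close> is at most a constant times
  \<open>2^n / H\<close>, so that rounding up does not spoil the upper bound.
\<close>

section \<open>Hamming balls\<close>

lemma finite_templates [simp]: "finite (templates n)"
  using finite_lists_length_eq[of "UNIV :: bool set" n] by (simp add: templates_def)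

lemma card_templates [simp]: "card (templates n) = 2 ^ n"
  using card_lists_length_eq[of "UNIV :: bool set" n] by (simp add: templates_def)

lemma length_templates: "x \<in> templates n \<Longrightarrow> length x = n"
  by (simp add: templates_def)

lemma templates_Suc: "templates (Suc n) = Cons True ` templates n \<union> Cons False ` templates n"
proof (intro equalityI subsetI)
  fix x assume "x \<in> templates (Suc n)"
  then obtain b y where "x = b # y" "y \<in> templates n"
    by (auto simp: templates_def length_Suc_conv)
  then show "x \<in> Cons True ` templates n \<union> Cons False ` templates n"
    by (cases b) auto
qed (auto simp: templates_def)

lemma sum_templates_Suc:
  fixes f :: "bool list \<Rightarrow> real"
  shows "(\<Sum>y\<in>templates (Suc n). f y) = (\<Sum>y\<in>templates n. f (True # y)) + (\<Sum>y\<in>templates n. f (False # y))"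
proof -
  have "(\<Sum>y\<in>templates (Suc n). f y) = sum f (Cons True ` templates n) + sum f (Cons False ` templates n)"
    unfolding templates_Suc by (rule sum.union_disjoint) auto
  also have "sum f (Cons True ` templates n) = (\<Sum>y\<in>templates n. f (True # y))"
    by (subst sum.reindex) auto
  also have "sum f (Cons False ` templates n) = (\<Sum>y\<in>templates n. f (False # y))"
    by (subst sum.reindex) auto
  finally show ?thesis .
qed

lemma hamming_Nil [simp]: "hamming [] y = 0"
  by (simp add: hamming_def)

lemma hamming_Cons [simp]: "hamming (a # x) (b # y) = (if a = b then 0 else 1) + hamming x y"
proof -
  have "{i. i < length (a # x) \<and> (a # x) ! i \<noteq> (b # y) ! i}
      = (if a = b then {} else {0}) \<union> Suc ` {i. i < length x \<and> x ! i \<noteq> y ! i}"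
    (is "?L = ?R")
  proof (rule set_eqI)
    show "i \<in> ?L \<longleftrightarrow> i \<in> ?R" for i
      by (cases i) (auto simp: image_iff)
  qed
  then show ?thesis
    unfolding hamming_def by (auto simp: card_image card_insert_if)
qed

lemma hamming_commute: "length x = length y \<Longrightarrow> hamming x y = hamming y x"
  by (simp add: hamming_def eq_commute)

lemma hamming_le_length: "hamming x y \<le> length x"
  unfolding hamming_def by (rule order_trans[OF card_mono[of "{..<length x}"]]) auto

lemma hball_subset_templates: "hball n eps c \<subseteq> templates n"
  by (auto simp: hball_def)

lemma finite_hball [simp]: "finite (hball n eps c)"
  using finite_subset[OF hball_subset_templates finite_templates] .

text \<open>The weight is a product over coordinates, and each coordinate contributes
  \<open>1 + \<mu>\<close> whatever its letter in \<open>c\<close>.\<close>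

lemma sum_power_hamming:
  fixes \<mu> :: real
  assumes "c \<in> templates n"
  shows "(\<Sum>y\<in>templates n. \<mu> ^ hamming c y) = (1 + \<mu>) ^ n"
  using assms
proof (induction n arbitrary: c)
  case 0
  then show ?case by (simp add: templates_def)
next
  case (Suc n)
  then obtain b d where c: "c = b # d" "d \<in> templates n"
    by (auto simp: templates_Suc)
  show ?case
    unfolding c sum_templates_Suc using Suc.IH[OF c(2)]
    by (cases b) (simp_all add: sum_distrib_left[symmetric] algebra_simps)
qed

text \<open>The offsets \<open>a\<close> and \<open>b\<close> carry the distances from coordinates
  already read, which makes the induction on \<open>n\<close> work. A coordinate where the centres
  agree gives a factor \<open>1 + \<mu>\<close>. One where they differ raises exactly one offset by
  1 and lowers \<open>d\<close> by 1, so \<open>a + b + d\<close> is kept and the two halves give a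
  factor 2. For \<open>d = 0\<close> the larger offset alone is at least half of
  \<open>a + b\<close>, rounded up.\<close>

lemma sum_power_max_hamming_le:
  fixes \<mu> :: real
  assumes "0 < \<mu>" "\<mu> \<le> 1" "c \<in> templates n" "c' \<in> templates n" "d \<le> hamming c c'"
  shows "(\<Sum>y\<in>templates n. \<mu> ^ max (a + hamming c y) (b + hamming c' y))
       \<le> (1 + \<mu>) ^ (n - d) * 2 ^ d * \<mu> ^ ((a + b + d + 1) div 2)"
  using assms(3-)
proof (induction n arbitrary: c c' a b d)
  case 0
  then show ?case
    using assms by (auto simp: templates_def intro!: power_decreasing)
next
  case (Suc n)
  show ?case
  proof (cases "d = 0")
    case True
    have *: "(\<Sum>y\<in>templates (Suc n). \<mu> ^ max (a + hamming c y) (b + hamming c' y))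
           \<le> (1 + \<mu>) ^ Suc n * \<mu> ^ ((a + b + 1) div 2)"
      if c: "c \<in> templates (Suc n)" and ab: "b \<le> a" for a b :: nat and c c'
    proof -
      have "(\<Sum>y\<in>templates (Suc n). \<mu> ^ max (a + hamming c y) (b + hamming c' y))
          \<le> (\<Sum>y\<in>templates (Suc n). \<mu> ^ a * \<mu> ^ hamming c y)"
        unfolding power_add[symmetric] using assms by (intro sum_mono power_decreasing) auto
      also have "\<dots> = \<mu> ^ a * (1 + \<mu>) ^ Suc n"
        using sum_power_hamming[OF c] by (simp add: sum_distrib_left[symmetric])
      also have "\<dots> \<le> \<mu> ^ ((a + b + 1) div 2) * (1 + \<mu>) ^ Suc n"
        using ab assms by (intro mult_right_mono power_decreasing) auto
      finally show ?thesis by (simp add: mult.commute)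
    qed
    show ?thesis
    proof (cases "b \<le> a")
      case True
      then show ?thesis using *[of c b a c'] Suc.prems \<open>d = 0\<close> by simp
    next
      case False
      then show ?thesis using *[of c' a b c] Suc.prems \<open>d = 0\<close> by (simp add: max.commute add.commute)
    qed
  next
    case False
    obtain h e where c: "c = h # e" "e \<in> templates n"
      using Suc.prems by (auto simp: templates_Suc)
    obtain h' e' where c': "c' = h' # e'" "e' \<in> templates n"
      using Suc.prems by (auto simp: templates_Suc)
    let ?F = "\<lambda>a b. \<Sum>y\<in>templates n. \<mu> ^ max (a + hamming e y) (b + hamming e' y)"
    show ?thesis
    proof (cases "h = h'")
      case True
      then have d: "d \<le> hamming e e'" using Suc.prems c c' by simp
      then have "d \<le> n" using hamming_le_length[of e e'] c by (simp add: templates_def)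
      have "(\<Sum>y\<in>templates (Suc n). \<mu> ^ max (a + hamming c y) (b + hamming c' y)) = ?F a b + \<mu> * ?F a b"
        unfolding c c' sum_templates_Suc sum_distrib_left using True
        by (cases h) simp_all
      also have "\<dots> = (1 + \<mu>) * ?F a b" by (simp add: algebra_simps)
      also have "\<dots> \<le> (1 + \<mu>) * ((1 + \<mu>) ^ (n - d) * 2 ^ d * \<mu> ^ ((a + b + d + 1) div 2))"
        using assms by (intro mult_left_mono Suc.IH c c' d) auto
      finally show ?thesis using \<open>d \<le> n\<close> by (simp add: Suc_diff_le mult_ac)
    next
      case False
      then have d: "d - 1 \<le> hamming e e'" using Suc.prems c c' by simp
      have "(\<Sum>y\<in>templates (Suc n). \<mu> ^ max (a + hamming c y) (b + hamming c' y)) = ?F (a + 1) b + ?F a (b + 1)"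
        unfolding c c' sum_templates_Suc using False
        by (cases h; cases h') (simp_all add: add.commute)
      also have "\<dots> \<le> ((1 + \<mu>) ^ (n - (d - 1)) * 2 ^ (d - 1) * \<mu> ^ ((a + 1 + b + (d - 1) + 1) div 2))
                   + ((1 + \<mu>) ^ (n - (d - 1)) * 2 ^ (d - 1) * \<mu> ^ ((a + (b + 1) + (d - 1) + 1) div 2))"
        by (intro add_mono Suc.IH c c' d)
      also have "\<dots> = (1 + \<mu>) ^ (Suc n - d) * 2 ^ d * \<mu> ^ ((a + b + d + 1) div 2)"
        using \<open>d \<noteq> 0\<close> by (cases d) simp_all
      finally show ?thesis .
    qed
  qed
qed

text \<open>A Chernoff-type bound: since \<open>\<mu> \<le> 1\<close>, every point of
  \<open>B\<close> has weight at least \<open>\<mu> ^ eps\<close>, and the other weights are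
  positive.\<close>

lemma card_le_weighted:
  fixes \<mu> :: real
  assumes "0 < \<mu>" "\<mu> \<le> 1" "B \<subseteq> templates n" "\<And>y. y \<in> B \<Longrightarrow> f y \<le> eps"
  shows "\<mu> ^ eps * real (card B) \<le> (\<Sum>y\<in>templates n. \<mu> ^ f y)"
proof -
  have "\<mu> ^ eps * real (card B) = (\<Sum>y\<in>B. \<mu> ^ eps)" by simp
  also have "\<dots> \<le> (\<Sum>y\<in>B. \<mu> ^ f y)"
    using assms by (intro sum_mono power_decreasing) auto
  also have "\<dots> \<le> (\<Sum>y\<in>templates n. \<mu> ^ f y)"
    using assms by (intro sum_mono2) auto
  finally show ?thesis .
qed

text \<open>\<open>\<mu>\<close> stays free: the odds ratio \<open>x / (1 - x)\<close> yields the
  entropy volume, while \<open>\<mu> = 1/4\<close> serves the covering argument.\<close>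

lemma card_hball_le:
  fixes \<mu> :: real
  assumes "0 < \<mu>" "\<mu> \<le> 1" "c \<in> templates n"
  shows "real (card (hball n eps c)) \<le> (1 + \<mu>) ^ n / \<mu> ^ eps"
proof -
  have "\<mu> ^ eps * real (card (hball n eps c)) \<le> (1 + \<mu>) ^ n"
    unfolding sum_power_hamming[OF assms(3), of \<mu>, symmetric]
    using assms by (intro card_le_weighted) (auto simp: hball_def)
  then show ?thesis
    using assms by (simp add: pos_le_divide_eq mult.commute)
qed

lemma card_hball_Int_le:
  fixes \<mu> :: real
  assumes "0 < \<mu>" "\<mu> \<le> 1" "c \<in> templates n" "c' \<in> templates n" "eps < hamming c c'"
  shows "real (card (hball n eps c \<inter> hball n eps c'))
       \<le> (1 + \<mu>) ^ n / \<mu> ^ eps * 2 ^ (eps + 1) * \<mu> ^ ((eps + 2) div 2)"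
proof -
  have "\<mu> ^ eps * real (card (hball n eps c \<inter> hball n eps c'))
      \<le> (\<Sum>y\<in>templates n. \<mu> ^ max (0 + hamming c y) (0 + hamming c' y))"
    using assms by (intro card_le_weighted) (auto simp: hball_def)
  \<comment> \<open>Here \<open>d = eps + 1\<close>, and \<open>(eps + 2) div 2\<close> is
    \<open>(eps + 1) / 2\<close> rounded up.\<close>
  also have "\<dots> \<le> (1 + \<mu>) ^ (n - (eps + 1)) * 2 ^ (eps + 1) * \<mu> ^ ((0 + 0 + (eps + 1) + 1) div 2)"
    using assms by (intro sum_power_max_hamming_le) auto
  also have "\<dots> \<le> (1 + \<mu>) ^ n * 2 ^ (eps + 1) * \<mu> ^ ((eps + 2) div 2)"
    using assms by (auto intro!: mult_right_mono power_increasing)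
  finally show ?thesis
    using assms by (simp add: pos_le_divide_eq mult.commute)
qed

text \<open>The sphere of radius \<open>eps\<close> suffices: flipping the letters of
  \<open>c\<close> at the positions in \<open>S\<close> embeds the \<open>eps\<close>-subsets into
  the ball.\<close>

lemma binomial_le_card_hball:
  assumes "c \<in> templates n"
  shows "n choose eps \<le> card (hball n eps c)"
proof -
  let ?S = "{S. S \<subseteq> {..<n} \<and> card S = eps}"
  let ?f = "\<lambda>S. map (\<lambda>i. (c ! i) \<noteq> (i \<in> S)) [0..<n]"
  have len: "length c = n" using assms by (rule length_templates)
  have nth: "?f S ! i = (c ! i \<noteq> (i \<in> S))" if "i < n" for S i using that by simp
  have "inj_on ?f ?S"
  proof (rule inj_onI)
    fix S S' assume S: "S \<in> ?S" "S' \<in> ?S" and eq: "?f S = ?f S'"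
    have "i \<in> S \<longleftrightarrow> i \<in> S'" if "i < n" for i
      using nth[OF that, of S] nth[OF that, of S'] arg_cong[OF eq, of "\<lambda>l. l ! i"] by argo
    then show "S = S'" using S by blast
  qed
  moreover have "?f ` ?S \<subseteq> hball n eps c"
  proof
    fix y assume "y \<in> ?f ` ?S"
    then obtain S where S: "S \<subseteq> {..<n}" "card S = eps" and y: "y = ?f S" by auto
    have "{i. i < length c \<and> c ! i \<noteq> y ! i} = S"
      using S unfolding y len by auto
    then show "y \<in> hball n eps c"
      using S by (simp add: hball_def hamming_def y templates_def)
  qed
  ultimately have "card ?S \<le> card (hball n eps c)"
    by (intro card_inj_on_le) auto
  then show ?thesis by (simp add: n_subsets)
qed

text \<open>The complementary word is at distance \<open>n\<close> from \<open>c\<close>. This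
  handles two users, where one ball must not fill the space.\<close>

lemma card_hball_less:
  assumes "c \<in> templates n" "eps < n"
  shows "card (hball n eps c) < 2 ^ n"
proof -
  have len: "length c = n" using assms by (simp add: templates_def)
  have "{i. i < length c \<and> c ! i \<noteq> map Not c ! i} = {..<n}" by (auto simp: len)
  then have "hamming c (map Not c) = n" by (simp add: hamming_def)
  then have "map Not c \<in> templates n - hball n eps c"
    using assms by (simp add: hball_def templates_def)
  then have "hball n eps c \<subset> templates n" using hball_subset_templates by blast
  from psubset_card_mono[OF finite_templates this] show ?thesis by simp
qed


section \<open>The probabilities\<close>

text \<open>A newly inserted set adds its own size minus its overlap with the earlier sets, which is
  at most \<open>card J * I\<close>; over all insertions the overlaps count the pairs.\<close>

lemma card_UN_ge_Bonferroni:
  fixes A :: "'a \<Rightarrow> 'b set"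
  assumes "finite J" "\<And>j. j \<in> J \<Longrightarrow> finite (A j)" "\<And>j. j \<in> J \<Longrightarrow> V \<le> real (card (A j))"
    and "\<And>i j. i \<in> J \<Longrightarrow> j \<in> J \<Longrightarrow> i \<noteq> j \<Longrightarrow> real (card (A i \<inter> A j)) \<le> I"
  shows "real (card J) * V - real (card J) * (real (card J) - 1) / 2 * I \<le> real (card (\<Union>j\<in>J. A j))"
  using assms
proof (induction J rule: finite_induct)
  case (insert i J)
  have fin: "finite (A i)" "finite (\<Union>j\<in>J. A j)" using insert by auto
  have "A i \<inter> (\<Union>j\<in>J. A j) = (\<Union>j\<in>J. A i \<inter> A j)" by blast
  then have "real (card (A i \<inter> (\<Union>j\<in>J. A j))) \<le> real (\<Sum>j\<in>J. card (A i \<inter> A j))"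
    using card_UN_le[OF insert.hyps(1), of "\<lambda>j. A i \<inter> A j"] by (simp only: of_nat_le_iff)
  also have "\<dots> \<le> (\<Sum>j\<in>J. I)"
    unfolding of_nat_sum using insert by (intro sum_mono insert.prems) auto
  finally have *: "real (card (A i \<inter> (\<Union>j\<in>J. A j))) \<le> real (card J) * I" by simp
  have "card (A i) + card (\<Union>j\<in>J. A j) = card (A i \<union> (\<Union>j\<in>J. A j)) + card (A i \<inter> (\<Union>j\<in>J. A j))"
    by (rule card_Un_Int) (use fin in auto)
  then have "real (card (A i)) + real (card (\<Union>j\<in>J. A j))
      = real (card (\<Union>j\<in>insert i J. A j)) + real (card (A i \<inter> (\<Union>j\<in>J. A j)))"
    by (simp flip: of_nat_add)
  moreover have "V \<le> real (card (A i))" using insert by auto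
  moreover have "real (card J) * V - real (card J) * (real (card J) - 1) / 2 * I \<le> real (card (\<Union>j\<in>J. A j))"
    using insert by auto
  ultimately show ?case
    using * insert.hyps by (simp add: field_simps)
qed simp

section \<open>Separated profiles and the conditional matching probabilities\<close>

lemma finite_profiles [simp]: "finite (profiles n N)"
  by (simp add: profiles_def finite_PiE)

lemma profiles_nth: "v \<in> profiles n N \<Longrightarrow> j \<in> {1..N} \<Longrightarrow> v j \<in> templates n"
  by (auto simp: profiles_def)

text \<open>Greedy (Gilbert--Varshamov) choice of the templates.\<close>
lemma exists_separated_profile:
  assumes "\<And>c. c \<in> templates n \<Longrightarrow> card (hball n eps c) \<le> V" "(N - 1) * V < 2 ^ n"
  shows "profiles n N - W0 n N eps \<noteq> {}"
  using assms(2)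
proof (induction N)
  case 0
  show ?case by (simp add: W0_def profiles_def)
next
  case (Suc N)
  have "(N - 1) * V \<le> N * V" by simp
  then have "(N - 1) * V < 2 ^ n" using Suc.prems by (simp only: diff_Suc_1)
  then obtain v where v: "v \<in> profiles n N" "v \<notin> W0 n N eps" using Suc.IH by auto
  let ?U = "\<Union>j\<in>{1..N}. hball n eps (v j)"
  have "card ?U \<le> (\<Sum>j\<in>{1..N}. card (hball n eps (v j)))" by (rule card_UN_le) simp
  also have "\<dots> \<le> (\<Sum>j\<in>{1..N}. V)"
    using v by (intro sum_mono assms(1) profiles_nth) auto
  also have "\<dots> = N * V" by simp
  also have "\<dots> < card (templates n)" using Suc.prems by simp
  finally have "\<not> templates n \<subseteq> ?U"
    using card_mono[of ?U "templates n"] by (meson finite_UN_I finite_atLeastAtMost finite_hball not_le)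
  then obtain w where w: "w \<in> templates n" "w \<notin> ?U" by blast
  have far: "eps < hamming (v j) w" if "j \<in> {1..N}" for j
    using w that by (auto simp: hball_def not_le)
  have sep: "eps < hamming (v i) (v j)" if "i \<in> {1..N}" "j \<in> {1..N}" "i \<noteq> j" for i j
    using v that by (force simp: W0_def)
  have far': "eps < hamming w (v j)" if "j \<in> {1..N}" for j
    using far[OF that] hamming_commute[of w "v j"] w profiles_nth[OF v(1) that]
    by (simp add: templates_def)
  let ?v = "v(Suc N := w)"
  have ins: "{1..Suc N} = insert (Suc N) {1..N}" by auto
  have "?v \<in> profiles n (Suc N)"
    using v(1) w(1) unfolding profiles_def ins by (intro PiE_fun_upd)
  moreover have "?v \<notin> W0 n (Suc N) eps"
    using far far' sep unfolding W0_def ins by (auto simp: not_le[symmetric])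
  ultimately show ?case by blast
qed

text \<open>The joint law is uniform on a product, so the conditional probability is a quotient of
  counts: the average over the collision-free profiles of the density of the union of balls.\<close>

lemma p_user_eq:
  assumes "profiles n N - W0 n N eps \<noteq> {}"
  shows "p_user n N eps k
    = (\<Sum>v\<in>profiles n N - W0 n N eps. real (card (\<Union>j\<in>{1..N} - {k}. hball n eps (v j))))
      / (real (card (profiles n N - W0 n N eps)) * 2 ^ n)"
proof -
  let ?S = "profiles n N \<times> templates n" and ?G = "profiles n N - W0 n N eps"
  let ?U = "\<lambda>v. \<Union>j\<in>{1..N} - {k}. hball n eps (v j)"
  let ?A = "{(v, w). w \<in> ?U v}" and ?B = "{(v, w). v \<notin> W0 n N eps}"
  have "templates n \<noteq> {}" using card_templates[of n] by (metis card.empty power_not_zero zero_neq_numeral)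
  then have S: "?S \<noteq> {}" "finite ?S" using assms by auto
  have UT: "?U v \<subseteq> templates n" for v using hball_subset_templates by blast
  have AB: "?S \<inter> (?A \<inter> ?B) = Sigma ?G ?U" using UT by auto
  have B: "?S \<inter> ?B = ?G \<times> templates n" by auto
  have fin: "finite ?G" by simp
  have "p_user n N eps k = (real (card (Sigma ?G ?U)) / real (card ?S)) / (real (card (?G \<times> templates n)) / real (card ?S))"
    unfolding p_user_def cond_prob_pmf_def sample_space_def
    by (simp only: measure_pmf_of_set[OF S] AB B)
  also have "\<dots> = real (card (Sigma ?G ?U)) / real (card (?G \<times> templates n))"
    using S by simp
  also have "card (Sigma ?G ?U) = (\<Sum>v\<in>?G. card (?U v))"
    using fin by (intro card_SigmaI) auto
  finally show ?thesis by (simp add: card_cartesian_product)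
qed

lemma p_user_bounds:
  assumes "profiles n N - W0 n N eps \<noteq> {}"
    and "\<And>v. v \<in> profiles n N - W0 n N eps \<Longrightarrow>
      real (card (\<Union>j\<in>{1..N} - {k}. hball n eps (v j))) \<in> {a..b}"
  shows "p_user n N eps k \<in> {a / 2 ^ n..b / 2 ^ n}"
proof -
  let ?G = "profiles n N - W0 n N eps"
  let ?u = "\<lambda>v. real (card (\<Union>j\<in>{1..N} - {k}. hball n eps (v j)))"
  have "card ?G > 0" using assms(1) by (simp add: card_gt_0_iff)
  moreover have "(\<Sum>v\<in>?G. ?u v) \<ge> real (card ?G) * a" "(\<Sum>v\<in>?G. ?u v) \<le> real (card ?G) * b"
    using assms(2) by (auto intro!: sum_bounded_below sum_bounded_above)
  ultimately show ?thesis
    unfolding p_user_eq[OF assms(1)] by (simp add: field_simps)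
qed

text \<open>The probability that a round fails is a product, so its negated logarithm is a sum, each
  term lying between \<open>a\<close> (by \<open>ln t \<le> t - 1\<close>) and
  \<open>- ln (1 - b)\<close>. The 1 added in the last bound is the cost of rounding up.\<close>

lemma m_in_bounds:
  assumes "\<And>k. k \<in> {1..N} \<Longrightarrow> p_user n N eps k \<in> {a..b}" "0 < a" "b < 1" "0 < N"
  shows "1 \<le> real_of_int (m_in n N eps)"
    and "ln 2 / (real N * - ln (1 - b)) \<le> real_of_int (m_in n N eps)"
    and "real_of_int (m_in n N eps) \<le> ln 2 / (real N * a) + 1"
proof -
  define P where "P = (\<Prod>k=1..N. (1 - p_user n N eps k))"
  have ab: "a \<le> b" using assms(1)[of 1] assms(4) by auto
  have p: "a \<le> p_user n N eps k" "p_user n N eps k \<le> b" if "k \<in> {1..N}" for k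
    using assms(1)[OF that] by auto
  have pw: "1 - p_w n N eps = P" by (simp add: p_w_def P_def)
  have pos: "1 - p_user n N eps k > 0" if "k \<in> {1..N}" for k using p[OF that] assms by linarith
  have lnP: "ln P = (\<Sum>k=1..N. ln (1 - p_user n N eps k))"
    unfolding P_def by (intro ln_prod) (use pos in force)+
  have "ln P \<le> (\<Sum>k=1..N. - a)"
    unfolding lnP
  proof (intro sum_mono)
    fix k assume k: "k \<in> {1..N}"
    have "ln (1 - p_user n N eps k) \<le> 1 - p_user n N eps k - 1"
      by (rule ln_le_minus_one) (rule pos[OF k])
    then show "ln (1 - p_user n N eps k) \<le> - a" using p[OF k] by linarith
  qed
  then have D1: "real N * a \<le> - ln P" by simp
  have "ln P \<ge> (\<Sum>k=1..N. ln (1 - b))"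
    unfolding lnP
  proof (intro sum_mono)
    fix k assume k: "k \<in> {1..N}"
    show "ln (1 - b) \<le> ln (1 - p_user n N eps k)"
      using p[OF k] assms pos[OF k] by simp
  qed
  then have D2: "- ln P \<le> real N * - ln (1 - b)" by simp
  have D0: "0 < real N * a" using assms by simp
  have m: "m_in n N eps = \<lceil>ln 2 / - ln P\<rceil>" by (simp add: m_in_def pw)
  \<comment> \<open>Every factor of \<open>P\<close> lies strictly between 0 and 1, so the quotient
    is positive and its ceiling at least 1.\<close>
  have Lpos: "0 < ln 2 / - ln P" using D0 D1 by (simp add: divide_pos_neg)
  then have "1 \<le> \<lceil>ln 2 / - ln P\<rceil>" by linarith
  then show "1 \<le> real_of_int (m_in n N eps)" unfolding m by linarith
  have "ln 2 / (real N * - ln (1 - b)) \<le> ln 2 / - ln P"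
    by (intro frac_le) (use D0 D1 D2 in auto)
  then show "ln 2 / (real N * - ln (1 - b)) \<le> real_of_int (m_in n N eps)" unfolding m by linarith
  have "ln 2 / - ln P \<le> ln 2 / (real N * a)"
    by (intro frac_le D0 D1) auto
  then show "real_of_int (m_in n N eps) \<le> ln 2 / (real N * a) + 1" unfolding m by linarith
qed


section \<open>Entropy bounds\<close>

lemma powr_bin_entropy:
  assumes "0 < eps" "eps < n"
  defines "x \<equiv> real eps / real n"
  shows "2 powr (real n * bin_entropy x) = 1 / (x ^ eps * (1 - x) ^ (n - eps))"
proof -
  have x: "0 < x" "x < 1" using assms by (auto simp: x_def)
  have nx: "real n * x = real eps" "real n * (1 - x) = real (n - eps)"
    using assms by (auto simp: x_def field_simps of_nat_diff)
  have "real n * bin_entropy x = - (real n * x * log 2 x) - real n * (1 - x) * log 2 (1 - x)"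
    by (simp add: bin_entropy_def algebra_simps)
  also have "\<dots> = - (log 2 (x ^ eps) + log 2 ((1 - x) ^ (n - eps)))"
    unfolding nx using x by (simp add: log_nat_power)
  also have "\<dots> = - log 2 (x ^ eps * (1 - x) ^ (n - eps))"
    using x by (subst log_mult) auto
  finally show ?thesis
    using x by (simp add: powr_minus divide_inverse)
qed

text \<open>The odds ratio is the minimiser of \<open>(1 + \<mu>) ^ n / \<mu> ^ eps\<close>; the
  minimum is the entropy volume.\<close>

lemma powr_bin_entropy_odds:
  assumes "0 < eps" "eps < n"
  defines "x \<equiv> real eps / real n"
  defines "\<mu> \<equiv> x / (1 - x)"
  shows "2 powr (real n * bin_entropy x) = (1 + \<mu>) ^ n / \<mu> ^ eps"
proof -
  have x: "0 < x" "x < 1" using assms by (auto simp: x_def)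
  have "1 + \<mu> = 1 / (1 - x)" using x by (simp add: \<mu>_def field_simps)
  moreover have "(1 - x) ^ n = (1 - x) ^ eps * (1 - x) ^ (n - eps)"
    using assms by (simp flip: power_add)
  ultimately have "(1 + \<mu>) ^ n / \<mu> ^ eps = 1 / (x ^ eps * (1 - x) ^ (n - eps))"
    using x by (simp add: \<mu>_def power_divide)
  then show ?thesis using powr_bin_entropy[OF assms(1,2)] by (simp add: x_def)
qed

text \<open>Gibbs' inequality, from \<open>t \<le> exp (t - 1)\<close>.\<close>
lemma powr_bin_entropy_le:
  assumes "0 < eps" "eps < n" "0 < y" "y < 1"
  shows "2 powr (real n * bin_entropy (real eps / real n)) \<le> 1 / (y ^ eps * (1 - y) ^ (n - eps))"
proof -
  define x where "x = real eps / real n"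
  have x: "0 < x" "x < 1" using assms by (auto simp: x_def)
  have nx: "real eps = real n * x" "real (n - eps) = real n * (1 - x)"
    using assms by (auto simp: x_def field_simps of_nat_diff)
  have ex: "t \<le> exp (t - 1)" for t :: real
    using exp_ge_add_one_self[of "t - 1"] by simp
  have "(y / x) ^ eps * ((1 - y) / (1 - x)) ^ (n - eps)
      \<le> exp (y / x - 1) ^ eps * exp ((1 - y) / (1 - x) - 1) ^ (n - eps)"
    using x assms by (intro mult_mono power_mono ex) auto
  also have "\<dots> = exp (real eps * (y / x - 1) + real (n - eps) * ((1 - y) / (1 - x) - 1))"
    by (simp add: exp_add exp_of_nat_mult)
  \<comment> \<open>The two summands are \<open>n * (y - x)\<close> and
    \<open>n * (x - y)\<close>.\<close>
  also have "real eps * (y / x - 1) + real (n - eps) * ((1 - y) / (1 - x) - 1) = 0"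
    unfolding nx using x by (simp add: field_simps)
  finally have "(y ^ eps * (1 - y) ^ (n - eps)) / (x ^ eps * (1 - x) ^ (n - eps)) \<le> 1"
    by (simp add: power_divide)
  then show ?thesis
    unfolding x_def[symmetric] powr_bin_entropy[OF assms(1,2), folded x_def] using x assms
    by (simp add: divide_simps)
qed

section \<open>Lower bound of Stirling type for binomial coefficients\<close>

lemma succ_ratio_power_antimono:
  fixes k m :: nat
  assumes "0 < k" "k \<le> m"
  shows "(real (Suc m) / real m) ^ (2 * m + 1) \<le> (real (Suc k) / real k) ^ (2 * k + 1)"
proof -
  define f where "f = (\<lambda>t::real. (2 * t + 1) * (ln (t + 1) - ln t))"
  have "f (real m) \<le> f (real k)"
  proof (rule DERIV_nonpos_imp_nonincreasing[where f = f])
    fix t :: real assume "real k \<le> t" "t \<le> real m"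
    then have t: "t > 0" using assms by linarith
    have "(f has_real_derivative 2 * (ln (t + 1) - ln t) + (2 * t + 1) * (1 / (t + 1) - 1 / t)) (at t)"
      unfolding f_def using t by (auto intro!: derivative_eq_intros)
    \<comment> \<open>The derivative of \<open>f\<close> is twice the integral of the reciprocal
      over \<open>[t, t + 1]\<close> minus twice its trapezoid approximation; convexity gives the
      sign.\<close>
    moreover have "2 * (ln (t + 1) - ln t) \<le> inverse t + inverse (t + 1)"
      using ln_inverse_approx_le[OF t zero_less_one] by simp
    then have "2 * (ln (t + 1) - ln t) + (2 * t + 1) * (1 / (t + 1) - 1 / t) \<le> 0"
      using t by (simp add: field_simps)
    ultimately show "\<exists>y. (f has_real_derivative y) (at t) \<and> y \<le> 0" by blast
  qed (use assms in auto)
  moreover have "(real (Suc j) / real j) ^ (2 * j + 1) = exp (f (real j))" if "0 < j" for j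
  proof -
    have "exp (f (real j)) = exp (real (2 * j + 1) * ln (real (Suc j) / real j))"
      using that by (simp add: f_def ln_div add.commute)
    also have "\<dots> = exp (ln (real (Suc j) / real j)) ^ (2 * j + 1)"
      by (rule exp_of_nat_mult)
    also have "\<dots> = (real (Suc j) / real j) ^ (2 * j + 1)"
      using that by (subst exp_ln) auto
    finally show ?thesis by simp
  qed
  ultimately show ?thesis using assms by simp
qed

text \<open>With \<open>u m = m^(2m+1) / (m!)\<^sup>2\<close> the claim is \<open>u k * u l \<ge> u (k + l) / 8\<close>.
  Since \<open>u (m + 1) / u m = (1 + 1/m)^(2m+1)\<close> decreases in \<open>m\<close>, the worst case is \<open>k = l = 1\<close>.\<close>
lemma binomial_ge_powr_bin_entropy:
  assumes "0 < eps" "eps < n"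
  defines "x \<equiv> real eps / real n"
  shows "2 powr (real n * bin_entropy x) / sqrt (8 * real eps * (1 - x)) \<le> real (n choose eps)"
proof -
  define u :: "nat \<Rightarrow> real" where "u m = real m ^ (2 * m + 1) / (fact m)\<^sup>2" for m
  define g :: "nat \<Rightarrow> real" where "g m = (real (Suc m) / real m) ^ (2 * m + 1)" for m
  have upos: "u m > 0" if "0 < m" for m using that by (simp add: u_def)
  have gpos: "g m > 0" if "0 < m" for m using that by (simp add: g_def)
  have uSuc: "u (Suc m) = g m * u m" if "0 < m" for m
  proof -
    have "real (Suc m) ^ (2 * Suc m + 1) = real (Suc m) ^ (2 * m + 1) * (real (Suc m))\<^sup>2"
      by (simp flip: power_add add: eval_nat_numeral)
    then show ?thesis
      using that by (simp add: u_def g_def power_divide fact_Suc power_mult_distrib del: of_nat_Suc power_Suc)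
  qed
  define f where "f k l = u k * u l / u (k + l)" for k l
  have step: "f k l \<le> f k (Suc l)" if "0 < k" "0 < l" for k l
  proof -
    have g: "g (k + l) \<le> g l"
      unfolding g_def by (rule succ_ratio_power_antimono) (use that in auto)
    have "f k (Suc l) = f k l * (g l / g (k + l))"
      unfolding f_def using uSuc[of l] uSuc[of "k + l"] that by (simp add: mult_ac)
    moreover have "f k l * 1 \<le> f k l * (g l / g (k + l))"
      using g gpos[of "k + l"] upos[of k] upos[of l] upos[of "k + l"] that
      by (intro mult_left_mono) (auto simp: f_def)
    ultimately show ?thesis by simp
  qed
  have mono: "f k 1 \<le> f k l" if "0 < k" "0 < l" for k l
    using that(2)
  proof (induction l rule: nat_induct_non_zero)
    case (Suc l)
    then show ?case using step[of k l] that by linarith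
  qed simp
  have "f 1 1 = 1 / 8" by (simp add: f_def u_def)
  \<comment> \<open>Raise one argument from 1 to \<open>eps\<close>, swap by symmetry, then raise
    the other from 1 to \<open>n - eps\<close>.\<close>
  moreover have "f 1 1 \<le> f 1 eps" using mono[of 1 eps] assms by simp
  moreover have "f 1 eps = f eps 1" by (simp add: f_def mult.commute)
  moreover have "f eps 1 \<le> f eps (n - eps)" using mono assms by simp
  ultimately have f8: "1 / 8 \<le> f eps (n - eps)" by linarith
  define k where "k = real eps"
  define l where "l = real (n - eps)"
  have nkl: "real n = k + l" using assms by (simp add: k_def l_def)
  have pos: "k > 0" "l > 0" using assms by (auto simp: k_def l_def)
  define H where "H = 2 powr (real n * bin_entropy x)"
  define C where "C = real (n choose eps)"
  have x: "x = k / (k + l)" "1 - x = l / (k + l)"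
    using pos by (simp_all add: x_def k_def[symmetric] nkl field_simps)
  have "(k + l) ^ n = (k + l) ^ eps * (k + l) ^ (n - eps)"
    using assms by (simp flip: power_add)
  then have H: "H = (k + l) ^ n / (k ^ eps * l ^ (n - eps))"
    unfolding H_def x_def powr_bin_entropy[OF assms(1,2)] unfolding x_def[symmetric] x(2) unfolding x(1)
    by (simp add: power_divide)
  have C: "C = fact n / (fact eps * fact (n - eps))"
    unfolding C_def using assms by (simp add: binomial_fact)
  \<comment> \<open>Here \<open>k * l / (k + l)\<close> equals \<open>eps * (1 - x)\<close>, so
    \<open>f8\<close> becomes the square of the claim.\<close>
  have "f eps (n - eps) = C\<^sup>2 / H\<^sup>2 * (k * l / (k + l))"
    using assms pos
    by (simp add: f_def u_def C H nkl k_def[symmetric] l_def[symmetric]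
        power_mult_distrib power_divide power_add field_simps flip: power_mult)
  moreover define P where "P = k * l / (k + l)"
  ultimately have f: "1 / 8 \<le> C\<^sup>2 / H\<^sup>2 * P" using f8 by simp
  have "P > 0" "H > 0" using pos by (auto simp: P_def H_def)
  with f have "H\<^sup>2 / (8 * P) \<le> C\<^sup>2" by (simp add: field_simps)
  then have "(H / sqrt (8 * real eps * (1 - x)))\<^sup>2 \<le> C\<^sup>2"
    using pos by (simp add: power_divide x(2) k_def[symmetric] P_def mult.assoc)
  then show ?thesis
    unfolding H_def[symmetric] C_def[symmetric]
    by (rule power2_le_imp_le) (simp add: C_def)
qed

text \<open>Gibbs' inequality against the fair coin, that is \<open>h(x) \<le> 1\<close>.\<close>

lemma powr_bin_entropy_le_2_power:
  assumes "0 < eps" "eps < n"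
  shows "2 powr (real n * bin_entropy (real eps / real n)) \<le> 2 ^ n"
proof -
  have "2 powr (real n * bin_entropy (real eps / real n)) \<le> 1 / ((1/2) ^ eps * (1 - 1/2) ^ (n - eps))"
    by (rule powr_bin_entropy_le) (use assms in auto)
  also have "\<dots> = 2 ^ n" using assms by (simp add: power_divide flip: power_add)
  finally show ?thesis .
qed

lemma nat_ceiling_half: "nat \<lceil>(real eps + 1) / 2\<rceil> = (eps + 2) div 2"
proof -
  have "\<lceil>(real eps + 1) / 2\<rceil> = int ((eps + 2) div 2)"
    by (cases "even eps") (auto elim!: evenE oddE simp: ceiling_eq_iff)
  then show ?thesis by simp
qed

section \<open>The admissible range of the number of users\<close>

text \<open>\<open>2 + T\<close> dominates the hypothesised bound on \<open>N\<close>.\<close>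
locale template_params =
  fixes n eps :: nat and x r s T :: real
  assumes eps_pos: "0 < eps" and eps_le: "2 * eps \<le> n"
  defines "x \<equiv> real eps / real n"
    and "r \<equiv> (1 - x) / x"
    and "s \<equiv> 1 / sqrt (8 * real eps * (1 - x))"
    and "T \<equiv> r ^ ((eps + 2) div 2) / 2 ^ eps * s"
begin

lemma eps_less: "eps < n" using eps_pos eps_le by linarith

lemma x_bounds: "0 < x" "x \<le> 1/2" "x < 1"
proof -
  show "0 < x" using eps_pos eps_less by (simp add: x_def)
  have "real (2 * eps) \<le> real n" using eps_le by (rule of_nat_mono)
  then show x2: "x \<le> 1/2" using eps_pos eps_less by (simp add: x_def field_simps)
  then show "x < 1" by simp
qed

text \<open>\<open>r + 1\<close> is \<open>1 / x\<close>. The identity turns \<open>eps\<close>-th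
  powers of \<open>exp (t * (r + 1))\<close> into \<open>n\<close>-th powers of
  \<open>exp t\<close>.\<close>

lemma r_eps: "(r + 1) * real eps = real n"
  using x_bounds eps_pos eps_less by (simp add: r_def x_def field_simps)

lemma r_ge_1: "1 \<le> r"
  using x_bounds by (simp add: r_def field_simps)

lemma s_pos: "0 < s"
  using x_bounds eps_pos by (simp add: s_def)

lemma s_sq: "s\<^sup>2 \<le> 1 / (4 * real eps)"
proof -
  have "4 * real eps \<le> 8 * real eps * (1 - x)" using x_bounds eps_pos by simp
  then show ?thesis
    using x_bounds eps_pos by (simp add: s_def power_divide field_simps)
qed

lemma T_nonneg: "0 \<le> T"
  using r_ge_1 s_pos by (simp add: T_def)

text \<open>\<open>T\<^sup>2\<close> is at most \<open>r ^ (eps + 2) / 4 ^ eps\<close>. With the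
  Gibbs bound at 1/4 the product is at most
  \<open>r\<^sup>2 * (3 * r / 4) ^ eps * (4/3) ^ n\<close>, and
  \<open>(3 * r / 4) ^ eps \<le> exp (1/3) ^ n\<close>. The resulting base is below 2, and the slack
  absorbs \<open>r\<^sup>2 \<le> n\<^sup>2\<close>.\<close>

lemma T_sq_mult_entropy_le: "T\<^sup>2 * 2 powr (real n * bin_entropy x) \<le> 841 * 2 ^ n"
proof -
  have e1: "exp (1/3) \<le> (7/5 :: real)"
  proof -
    have "exp (1/3) ^ 3 = exp (1 :: real)" by (simp flip: exp_of_nat_mult)
    also have "\<dots> \<le> (7/5) ^ 3" using e_less_272 by (simp add: power3_eq_cube)
    finally show ?thesis by (subst (asm) power_mono_iff) auto
  qed
  \<comment> \<open>From \<open>t \<le> exp (t - 1)\<close> at \<open>t = (r + 1) / 3\<close> and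
    \<open>exp 1 \<ge> 5/2\<close>, as \<open>5/6 * (r + 1) \<ge> 3/4 * r\<close>.\<close>
  have e2: "3 * r / 4 \<le> exp ((r + 1) / 3)"
  proof -
    have "exp 1 \<ge> (5/2 :: real)"
      using exp_lower_Taylor_quadratic[of "1::real"] by simp
    have "(r + 1) / 3 \<le> exp ((r + 1) / 3 - 1)"
      using exp_ge_add_one_self[of "(r + 1) / 3 - 1"] by simp
    then have "5/2 * ((r + 1) / 3) \<le> exp 1 * exp ((r + 1) / 3 - 1)"
      using \<open>exp 1 \<ge> 5/2\<close> r_ge_1 by (intro mult_mono) auto
    then show ?thesis using r_ge_1 by (simp flip: exp_add)
  qed
  have "(3 * r / 4) ^ eps \<le> exp ((r + 1) / 3) ^ eps"
    using e2 r_ge_1 by (intro power_mono) auto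
  also have "\<dots> = exp (1/3) ^ n"
    unfolding exp_of_nat_mult[symmetric] r_eps[symmetric] by (simp add: mult.commute)
  also have "\<dots> \<le> (7/5) ^ n" using e1 by (intro power_mono) auto
  finally have pw: "(3 * r / 4) ^ eps \<le> (7/5) ^ n" .
  have H: "2 powr (real n * bin_entropy x) \<le> 4 ^ eps * ((3/4) ^ eps * (4/3) ^ n)"
  proof -
    \<comment> \<open>\<open>y = 1/4\<close> makes the base \<open>exp (1/3) * 4/3\<close> of the final estimate less than 2.\<close>
    have "2 powr (real n * bin_entropy x) \<le> 1 / ((1/4) ^ eps * (1 - 1/4) ^ (n - eps))"
      unfolding x_def by (rule powr_bin_entropy_le) (use eps_pos eps_less in auto)
    also have "\<dots> = 4 ^ eps * (4/3) ^ (n - eps)" by (simp add: power_divide)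
    also have "(4/3) ^ (n - eps) = (3/4) ^ eps * (4/3 :: real) ^ n"
      using eps_less by (simp add: power_diff power_divide)
    finally show ?thesis .
  qed
  have "r * 1 \<le> (r + 1) * real eps"
    using eps_pos r_ge_1 by (intro mult_mono) auto
  then have rn: "r \<le> real n" by (simp add: r_eps)
  have "r ^ ((eps + 2) div 2 * 2) \<le> r ^ (eps + 2)"
    using r_ge_1 by (intro power_increasing) auto
  moreover have "s\<^sup>2 \<le> 1"
  proof -
    have "1 \<le> real eps" using eps_pos by simp
    then have "1 / (4 * real eps) \<le> 1" by simp
    then show ?thesis using s_sq by linarith
  qed
  ultimately have "T\<^sup>2 \<le> r ^ (eps + 2) / 4 ^ eps * 1"
    unfolding T_def power_mult_distrib power_divide power_mult[symmetric]
    using r_ge_1 by (intro mult_mono divide_mono) (auto simp: mult.commute[of eps] power_mult)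
  then have "T\<^sup>2 * 2 powr (real n * bin_entropy x)
      \<le> r ^ (eps + 2) / 4 ^ eps * 1 * (4 ^ eps * ((3/4) ^ eps * (4/3) ^ n))"
    using H r_ge_1 by (intro mult_mono) auto
  also have "\<dots> = r\<^sup>2 * ((3 * r / 4) ^ eps * (4/3) ^ n)"
    by (simp add: power_add power_mult_distrib power_divide field_simps power2_eq_square)
  also have "\<dots> \<le> (real n)\<^sup>2 * ((7/5) ^ n * (4/3) ^ n)"
    using rn r_ge_1 pw by (intro mult_mono power_mono) auto
  also have "\<dots> = (real n)\<^sup>2 * ((14/15) ^ n * 2 ^ n)"
    by (simp flip: power_mult_distrib)
  \<comment> \<open>\<open>(29/30)\<^sup>2 = 841/900\<close> just exceeds \<open>14/15\<close>. Each
    factor \<open>n\<close> receives one power of \<open>29/30\<close>, and Bernoulli's inequality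
    bounds \<open>n * (29/30) ^ n\<close> by 29, whence 841.\<close>
  also have "\<dots> \<le> (real n)\<^sup>2 * ((29/30) ^ n * (29/30) ^ n * 2 ^ n)"
    unfolding power_mult_distrib[symmetric]
    by (intro mult_left_mono power_mono) auto
  also have "\<dots> = (real n * (29/30) ^ n)\<^sup>2 * 2 ^ n"
    by (simp add: power2_eq_square)
  also have "\<dots> \<le> 29\<^sup>2 * 2 ^ n"
  proof (intro mult_right_mono power_mono)
    have "1 + real n * (1/29) \<le> (1 + 1/29) ^ n"
      by (rule Bernoulli_inequality) simp
    then have "real n \<le> 29 * (30/29) ^ n" by simp
    then have "real n * (29/30) ^ n \<le> 29 * (30/29) ^ n * (29/30) ^ n"
      by (intro mult_right_mono) auto
    also have "\<dots> = 29" by (simp add: mult.assoc flip: power_mult_distrib)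
    finally show "real n * (29/30) ^ n \<le> 29" .
  qed auto
  finally show ?thesis by simp
qed

text \<open>The factor \<open>4 ^ eps * (5/4) ^ n\<close> is the bound of \<open>card_hball_le\<close> at \<open>\<mu> = 1/4\<close>.\<close>
lemma volume_bound_eps_1:
  assumes "eps = 1"
  shows "2 * T * (4 ^ eps * (5/4) ^ n) < 2 ^ n"
proof -
  have n: "2 \<le> n" using eps_le assms by simp
  have r: "r = real n - 1" using r_eps assms by simp
  have "s \<le> 1/2"
    by (rule power2_le_imp_le) (use s_sq assms in \<open>auto simp: power2_eq_square\<close>)
  then have "r * s \<le> r * (1/2)" using r_ge_1 by (intro mult_left_mono) auto
  then have "2 * T * 4 \<le> 2 * (real n - 1)"
    by (simp add: T_def assms r)
  also have "\<dots> < (8/5) ^ n"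
  \<comment> \<open>The inductive step needs \<open>m \<ge> 3\<close>, so \<open>n = 2\<close> is
    checked alone. The base is chosen so that \<open>8/5 * 5/4 = 2\<close>.\<close>
  proof (cases "n = 2")
    case False
    then have "3 \<le> n" using n by simp
    then show ?thesis
    proof (induction n rule: dec_induct)
      case (step m)
      have "2 * (real (Suc m) - 1) \<le> 8/5 * (2 * (real m - 1))" using step by simp
      also have "\<dots> < 8/5 * (8/5) ^ m" using step by simp
      finally show ?case by simp
    qed (simp add: power3_eq_cube)
  qed (simp add: power2_eq_square)
  finally have "2 * T * 4 * (5/4) ^ n < (8/5) ^ n * (5/4) ^ n"
    by (intro mult_strict_right_mono) auto
  then show ?thesis
    using assms by (simp flip: power_mult_distrib)
qed

text \<open>With \<open>q = sqrt r\<close> the left side is at most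
  \<open>2 * r * s * (2 * q) ^ eps * (5/4) ^ n\<close>. Here \<open>2 * r * s\<close> is below
  \<open>(117/100) ^ n\<close>, the power of \<open>2 * q\<close> is at most
  \<open>(1367/1000) ^ n\<close>, and \<open>1.17 * 1.367 * 1.25\<close> is just below 2.\<close>

lemma volume_bound_eps_ge_2:
  assumes "1 \<le> T" "2 \<le> eps"
  shows "2 * T * (4 ^ eps * (5/4) ^ n) < 2 ^ n"
proof -
  define q where "q = sqrt r"
  have q: "q\<^sup>2 = r" "1 \<le> q" using r_ge_1 by (auto simp: q_def)
  \<comment> \<open>0.3537 slightly exceeds \<open>1 / sqrt 8\<close>, the bound from
    \<open>s_sq\<close> at \<open>eps = 2\<close>.\<close>
  have s: "s \<le> 3537/10000"
  proof (rule power2_le_imp_le)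
    have "1 / (4 * real eps) \<le> 1 / (4 * 2)" using assms by (intro divide_left_mono) auto
    then show "s\<^sup>2 \<le> (3537/10000)\<^sup>2" using s_sq by (simp add: power2_eq_square)
  qed simp
  have "r ^ ((eps + 2) div 2) = q ^ (2 * ((eps + 2) div 2))"
    by (simp only: q(1)[symmetric] power_mult)
  also have "\<dots> \<le> q ^ (eps + 2)"
    using q by (intro power_increasing) auto
  finally have "T \<le> q ^ (eps + 2) / 2 ^ eps * s"
    unfolding T_def using s_pos by (intro mult_right_mono divide_right_mono) auto
  also have "\<dots> = (q / 2) ^ eps * (r * s)"
    by (simp add: power_add power_divide q(1)[symmetric] power2_eq_square)
  finally have T: "T \<le> (q / 2) ^ eps * (r * s)" .
  \<comment> \<open>Only with this gain from \<open>1 \<le> T\<close> do the constants work for every \<open>n\<close>.\<close>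
  have r3: "3 \<le> r"
  proof (rule ccontr)
    assume "\<not> 3 \<le> r"
    then have r: "r < 3" by simp
    have "q \<le> 2" by (rule power2_le_imp_le) (use r q in auto)
    then have "(q / 2) ^ eps \<le> (q / 2) ^ 2"
      using q assms by (intro power_decreasing) auto
    also have "\<dots> = r / 4" by (simp add: power_divide q)
    finally have "(q / 2) ^ eps * (r * s) \<le> (3 / 4) * (3 * (3537/10000))"
      using r r_ge_1 s s_pos by (intro mult_mono) auto
    then show False using T assms by simp
  qed
  have e: "exp 1 \<le> (27183/10000 :: real)" "(271/100 :: real) \<le> exp 1"
    using e_approx_32 by (simp_all add: abs_if split: if_split_asm)
  have e1: "exp (5/16) \<le> (1367/1000 :: real)"
  proof -
    have "exp (5/16) ^ 16 = exp (1 :: real) ^ 5" by (simp flip: exp_of_nat_mult)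
    also have "\<dots> \<le> (27183/10000) ^ 5" using e by (intro power_mono) auto
    also have "\<dots> \<le> (1367/1000) ^ 16" by (simp add: eval_nat_numeral)
    finally show ?thesis by (subst (asm) power_mono_iff) auto
  qed
  \<comment> \<open>Squared, this is \<open>4 * r \<le> exp (5/8 * (r + 1))\<close>. At
    \<open>r = 3\<close> it follows from \<open>12 \<le> exp (5/2)\<close>, and above 3 from a
    linear lower bound of slope 15/2. It fails at \<open>r = 1\<close>, hence
    \<open>r3\<close>.\<close>
  have e2: "2 * q \<le> exp (5/16 * (r + 1))"
  proof (rule power2_le_imp_le)
    have "(12 :: real) \<le> exp (5/2)"
    proof -
      have "(12 :: real)\<^sup>2 \<le> (271/100) ^ 5" by (simp add: eval_nat_numeral)
      also have "\<dots> \<le> exp 1 ^ 5" using e by (intro power_mono) auto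
      also have "\<dots> = (exp (5/2))\<^sup>2" by (simp flip: exp_of_nat_mult)
      finally show ?thesis by (rule power2_le_imp_le) simp
    qed
    moreover have "1 + 5/8 * (r - 3) \<le> exp (5/8 * (r - 3))"
      by (rule exp_ge_add_one_self)
    ultimately have "12 * (1 + 5/8 * (r - 3)) \<le> exp (5/2) * exp (5/8 * (r - 3))"
      using r3 by (intro mult_mono) auto
    also have "\<dots> = (exp (5/16 * (r + 1)))\<^sup>2"
      by (simp add: field_simps flip: exp_add exp_of_nat_mult)
    finally have "12 * (1 + 5/8 * (r - 3)) \<le> (exp (5/16 * (r + 1)))\<^sup>2" .
    moreover have "(2 * q)\<^sup>2 \<le> 12 * (1 + 5/8 * (r - 3))"
      using r3 by (simp add: power_mult_distrib q field_simps)
    ultimately show "(2 * q)\<^sup>2 \<le> (exp (5/16 * (r + 1)))\<^sup>2" by linarith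
  qed simp
  have "(2 * q) ^ eps \<le> exp (5/16 * (r + 1)) ^ eps"
    using e2 q by (intro power_mono) auto
  also have "\<dots> = exp (5/16) ^ n"
    unfolding exp_of_nat_mult[symmetric] r_eps[symmetric] by (simp add: mult_ac)
  also have "\<dots> \<le> (1367/1000) ^ n" using e1 by (intro power_mono) auto
  finally have pw: "(2 * q) ^ eps \<le> (1367/1000) ^ n" .
  have "r * 2 \<le> (r + 1) * real eps"
    using assms r_ge_1 by (intro mult_mono) auto
  then have "2 * (r * s) \<le> real n * (3537/10000)"
    unfolding r_eps using mult_mono[of "r * 2" "real n" s "3537/10000"] s s_pos r_ge_1
    by (simp add: mult_ac)
  also have "\<dots> < (117/100) ^ n"
  \<comment> \<open>From 6 on, \<open>m + 1 \<le> 1.17 * m\<close> drives the induction; smaller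
    \<open>n\<close> are computed.\<close>
  proof (cases "6 \<le> n")
    case True
    then show ?thesis
    proof (induction n rule: dec_induct)
      case (step m)
      have "real (Suc m) * (3537/10000) \<le> 117/100 * (real m * (3537/10000))" using step by simp
      also have "\<dots> < 117/100 * (117/100) ^ m" using step by simp
      finally show ?case by simp
    qed (simp add: eval_nat_numeral)
  next
    case False
    then have "n \<in> {0,1,2,3,4,5}" by auto
    then show ?thesis by (auto simp: eval_nat_numeral)
  qed
  finally have rs: "2 * (r * s) < (117/100) ^ n" .
  have "2 * T * (4 ^ eps * (5/4) ^ n) \<le> 2 * ((q / 2) ^ eps * (r * s)) * (4 ^ eps * (5/4) ^ n)"
    using T by (intro mult_right_mono mult_left_mono) auto
  also have "\<dots> = 2 * (r * s) * ((q / 2 * 4) ^ eps * (5/4) ^ n)"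
    unfolding power_mult_distrib[of "q / 2" 4] by (simp only: mult_ac)
  also have "\<dots> \<le> 2 * (r * s) * ((1367/1000) ^ n * (5/4) ^ n)"
    using pw r_ge_1 s_pos by (intro mult_left_mono mult_right_mono) (auto simp: mult.commute)
  also have "\<dots> < (117/100) ^ n * ((1367/1000) ^ n * (5/4) ^ n)"
    using rs by (intro mult_strict_right_mono) auto
  also have "\<dots> \<le> 2 ^ n"
    unfolding power_mult_distrib[symmetric] by (intro power_mono) auto
  finally show ?thesis .
qed

text \<open>For three or more users the range of \<open>N\<close> forces \<open>T \<ge> 1\<close>
  and \<open>N - 1 \<le> 1 + T \<le> 2 * T\<close>, so this shows that \<open>N - 1\<close> balls
  cannot cover the space.\<close>

lemma volume_bound:
  assumes "1 \<le> T"
  shows "2 * T * (4 ^ eps * (5/4) ^ n) < 2 ^ n"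
  using volume_bound_eps_1 volume_bound_eps_ge_2[OF assms] eps_pos by (cases "eps = 1") auto

end

section \<open>The median number of rounds\<close>

context template_params
begin

section \<open>Balls and their unions measured by the entropy volume\<close>

definition "entvol = 2 powr (real n * bin_entropy x)"

lemma entvol_pos: "0 < entvol"
  by (simp add: entvol_def)

lemma card_hball_ge_entvol:
  assumes "c \<in> templates n"
  shows "s * entvol \<le> real (card (hball n eps c))"
proof -
  have "s * entvol \<le> real (n choose eps)"
    using binomial_ge_powr_bin_entropy[OF eps_pos eps_less]
    by (simp add: entvol_def s_def x_def)
  also have "\<dots> \<le> real (card (hball n eps c))"
    using binomial_le_card_hball[OF assms, of eps] by simp
  finally show ?thesis .
qed

lemma odds_bounds: "0 < x / (1 - x)" "x / (1 - x) \<le> 1"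
  using x_bounds by (auto simp: field_simps)

lemma entvol_odds: "entvol = (1 + x / (1 - x)) ^ n / (x / (1 - x)) ^ eps"
  unfolding entvol_def x_def by (rule powr_bin_entropy_odds[OF eps_pos eps_less])

lemma card_hball_le_entvol:
  assumes "c \<in> templates n"
  shows "real (card (hball n eps c)) \<le> entvol"
  unfolding entvol_odds by (rule card_hball_le) (use odds_bounds assms in auto)

text \<open>This is \<open>card_hball_Int_le\<close> at \<open>\<mu> = 1 / r\<close>; the factor 2
  is left over from \<open>2 ^ (eps + 1)\<close>.\<close>

lemma card_hball_Int_le_entvol:
  assumes "c \<in> templates n" "c' \<in> templates n" "eps < hamming c c'"
  shows "real (card (hball n eps c \<inter> hball n eps c')) \<le> 2 * entvol / (r ^ ((eps + 2) div 2) / 2 ^ eps)"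
proof -
  have "real (card (hball n eps c \<inter> hball n eps c'))
      \<le> entvol * 2 ^ (eps + 1) * (x / (1 - x)) ^ ((eps + 2) div 2)"
    unfolding entvol_odds by (rule card_hball_Int_le) (use odds_bounds assms in auto)
  also have "x / (1 - x) = 1 / r" by (simp add: r_def)
  finally show ?thesis by (simp add: power_divide mult_ac)
qed

text \<open>Bonferroni with \<open>(N - 1) * (N - 2) / 2\<close> pairs: the 1/2 cancels the 2 in the
  intersection bound, leaving \<open>s - (N - 2) / B\<close>, which is at least
  \<open>\<delta>\<close> exactly by the hypothesis on \<open>N\<close>.\<close>

lemma card_union_ge:
  assumes N: "2 \<le> N" and hyp: "real N \<le> 2 + r ^ ((eps + 2) div 2) / 2 ^ eps * (s - \<delta>)"
    and v: "v \<in> profiles n N - W0 n N eps" and k: "k \<in> {1..N}"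
  shows "(real N - 1) * (entvol * \<delta>) \<le> real (card (\<Union>j\<in>{1..N} - {k}. hball n eps (v j)))"
proof -
  define B where "B = r ^ ((eps + 2) div 2) / 2 ^ eps"
  have Bpos: "B > 0" using r_ge_1 by (simp add: B_def)
  have J: "real (card ({1..N} - {k})) = real N - 1" using k N by (simp add: of_nat_diff)
  have vT: "v j \<in> templates n" if "j \<in> {1..N}" for j using v that profiles_nth by blast
  have sep: "eps < hamming (v i) (v j)" if "i \<in> {1..N}" "j \<in> {1..N}" "i \<noteq> j" for i j
    using v that by (force simp: W0_def)
  have "(real N - 1) * (s * entvol) - (real N - 1) * (real N - 1 - 1) / 2 * (2 * entvol / B)
      \<le> real (card (\<Union>j\<in>{1..N} - {k}. hball n eps (v j)))"
    unfolding J[symmetric] B_def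
    by (intro card_UN_ge_Bonferroni card_hball_ge_entvol card_hball_Int_le_entvol) (auto intro: vT sep)
  also have "(real N - 1) * (s * entvol) - (real N - 1) * (real N - 1 - 1) / 2 * (2 * entvol / B)
      = (real N - 1) * (entvol * (s - (real N - 2) / B))"
    by (simp add: algebra_simps diff_divide_distrib add_divide_distrib)
  finally have *: "(real N - 1) * (entvol * (s - (real N - 2) / B))
      \<le> real (card (\<Union>j\<in>{1..N} - {k}. hball n eps (v j)))" .
  have "\<delta> \<le> s - (real N - 2) / B"
    using hyp[folded B_def] Bpos by (simp add: field_simps)
  then have "(real N - 1) * (entvol * \<delta>) \<le> (real N - 1) * (entvol * (s - (real N - 2) / B))"
    using N entvol_pos by (intro mult_left_mono) auto
  then show ?thesis using * by linarith
qed

text \<open>\<open>V\<close> is a parameter because two bounds are used: an integer one that keeps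
  the union below \<open>2 ^ n\<close>, and the entropy volume, which has the right order.\<close>

lemma card_union_le:
  assumes N: "2 \<le> N" and "v \<in> profiles n N - W0 n N eps" and k: "k \<in> {1..N}"
    and V: "\<And>c. c \<in> templates n \<Longrightarrow> real (card (hball n eps c)) \<le> V"
  shows "real (card (\<Union>j\<in>{1..N} - {k}. hball n eps (v j))) \<le> (real N - 1) * V"
proof -
  have "real (card (\<Union>j\<in>{1..N} - {k}. hball n eps (v j)))
      \<le> real (\<Sum>j\<in>{1..N} - {k}. card (hball n eps (v j)))"
    by (intro of_nat_mono card_UN_le) auto
  also have "\<dots> \<le> (\<Sum>j\<in>{1..N} - {k}. V)"
    unfolding of_nat_sum using assms profiles_nth by (intro sum_mono V) blast
  also have "\<dots> = (real N - 1) * V" using k N by (simp add: of_nat_diff)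
  finally show ?thesis .
qed

text \<open>For \<open>N = 2\<close> it suffices that one ball is proper, even when
  \<open>T < 1\<close>. Otherwise \<open>T \<ge> 1\<close>, and the bound at
  \<open>\<mu> = 1/4\<close>, rounded down, is a suitable natural number.\<close>

lemma exists_volume_bound:
  assumes N: "2 \<le> N" and "real N \<le> 2 + T"
  obtains V where "\<And>c. c \<in> templates n \<Longrightarrow> card (hball n eps c) \<le> V" "(N - 1) * V < 2 ^ n"
proof (cases "N = 2")
  case True
  have "card (hball n eps c) \<le> 2 ^ n - 1" if "c \<in> templates n" for c
    using card_hball_less[OF that eps_less] by linarith
  moreover have "(N - 1) * (2 ^ n - 1) < 2 ^ n" using True by simp
  ultimately show ?thesis using that by blast
next
  case False
  then have N3: "real N - 2 \<ge> 1" using N by simp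
  define V where "V = nat \<lfloor>4 ^ eps * (5/4 :: real) ^ n\<rfloor>"
  have "card (hball n eps c) \<le> V" if "c \<in> templates n" for c
    using card_hball_le[OF _ _ that, of "1/4" eps] unfolding V_def
    by (intro le_nat_floor) (simp add: power_divide mult.commute)
  moreover have "(N - 1) * V < 2 ^ n"
  proof -
    have "real V \<le> 4 ^ eps * (5/4) ^ n" unfolding V_def by simp
    moreover have "real (N - 1) \<le> 2 * T" using assms N3 by (simp add: of_nat_diff)
    ultimately have "real (N - 1) * real V \<le> 2 * T * (4 ^ eps * (5/4) ^ n)"
      using T_nonneg by (intro mult_mono) auto
    also have "\<dots> < 2 ^ n" using assms N3 by (intro volume_bound) auto
    finally have "real ((N - 1) * V) < real (2 ^ n)" by simp
    then show ?thesis by (simp only: of_nat_less_iff)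
  qed
  ultimately show ?thesis using that by blast
qed

lemma m_in_asymptotics:
  assumes N: "2 \<le> N" and hyp: "real N \<le> 2 + r ^ ((eps + 2) div 2) / 2 ^ eps * (s - \<delta>)" and \<delta>: "0 < \<delta>"
  shows "1/4 * (2 ^ n / entvol) / real N ^ 3 \<le> real_of_int (m_in n N eps)"
    and "real_of_int (m_in n N eps) \<le> 2000 * (2 ^ n / entvol / \<delta>) / (real N)\<^sup>2"
proof -
  define B where "B = r ^ ((eps + 2) div 2) / 2 ^ eps"
  have Bpos: "B > 0" using r_ge_1 by (simp add: B_def)
  have "B * (s - \<delta>) \<le> T" unfolding T_def B_def[symmetric]
    using Bpos \<delta> by (intro mult_left_mono) auto
  then have NT: "real N \<le> 2 + T" using hyp by (simp add: B_def)
  \<comment> \<open>As \<open>N \<ge> 2\<close>, the hypothesis forces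
    \<open>\<delta> \<le> s\<close>.\<close>
  have "0 \<le> B * (s - \<delta>)" using hyp N by (simp add: B_def)
  then have "\<delta> \<le> s" using Bpos by (simp add: zero_le_mult_iff)
  moreover have "s \<le> 1"
  proof (rule power2_le_imp_le)
    have "1 / (4 * real eps) \<le> 1" using eps_pos by (simp add: divide_simps)
    then show "s\<^sup>2 \<le> 1\<^sup>2" using s_sq by simp
  qed simp
  ultimately have \<delta>1: "\<delta> \<le> 1" by simp
  obtain V where V: "\<And>c. c \<in> templates n \<Longrightarrow> card (hball n eps c) \<le> V" "(N - 1) * V < 2 ^ n"
    using exists_volume_bound[OF N NT] by blast
  have G: "profiles n N - W0 n N eps \<noteq> {}" by (rule exists_separated_profile[OF V])
  define Q where "Q = 2 ^ n / entvol"
  have Q: "0 < Q" using entvol_pos by (simp add: Q_def)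
  have eQ: "entvol / 2 ^ n = 1 / Q" by (simp add: Q_def)
  define a where "a = (real N - 1) * (entvol * \<delta>) / 2 ^ n"
  have a: "a = (real N - 1) * \<delta> / Q" using eQ by (simp add: a_def Q_def)
  have a0: "0 < a" using N \<delta> Q by (simp add: a)
  have pb: "p_user n N eps k \<in> {a..(real N - 1) * W / 2 ^ n}"
    if "k \<in> {1..N}" and W: "\<And>c. c \<in> templates n \<Longrightarrow> real (card (hball n eps c)) \<le> W" for k W
    unfolding a_def
    using card_union_ge[OF N hyp _ that(1)] card_union_le[OF N _ that(1) W]
    by (intro p_user_bounds[OF G]) auto
  \<comment> \<open>\<open>b\<close> certifies that the probabilities stay below 1;
    \<open>b'\<close> below has the right order but may reach 1.\<close>
  define b where "b = (real N - 1) * real V / 2 ^ n"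
  have "real ((N - 1) * V) < real (2 ^ n)" using V(2) by (simp only: of_nat_less_iff)
  then have b1: "b < 1" using N by (simp add: b_def of_nat_diff)
  have pb1: "p_user n N eps k \<in> {a..b}" if "k \<in> {1..N}" for k
    unfolding b_def by (rule pb[OF that]) (simp add: V)
  have N0: "0 < N" using N by simp
  note m1 = m_in_bounds[OF pb1 a0 b1 N0]
  define b' where "b' = (real N - 1) / Q"
  have pb2: "p_user n N eps k \<in> {a..b'}" if "k \<in> {1..N}" for k
    using pb[OF that card_hball_le_entvol] by (simp add: b'_def Q_def)
  show "1/4 * (2 ^ n / entvol) / real N ^ 3 \<le> real_of_int (m_in n N eps)"
    unfolding Q_def[symmetric]
  \<comment> \<open>For small \<open>b'\<close> the logarithm is linear up to a factor 2. Otherwise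
    \<open>Q \<le> 2 * N\<close>, so the claimed bound is at most 1, which \<open>m_in\<close>
    always reaches.\<close>
  proof (cases "b' \<le> 1/2")
    case True
    have b'0: "0 < b'" using N Q by (simp add: b'_def)
    have "- ln (1 - b') \<le> 2 * b'"
    proof -
      have "ln (inverse (1 - b')) \<le> inverse (1 - b') - 1"
        using True by (intro ln_le_minus_one) auto
      also have "\<dots> \<le> 2 * b'" using True b'0 by (simp add: field_simps)
      finally show ?thesis using True by (simp add: ln_inverse)
    qed
    moreover have "0 < - ln (1 - b')" using True b'0 by simp
    ultimately have "ln 2 / (real N * (2 * b')) \<le> ln 2 / (real N * - ln (1 - b'))"
      using N by (intro frac_le mult_left_mono mult_pos_pos) auto
    also have "\<dots> \<le> real_of_int (m_in n N eps)"
      by (rule m_in_bounds(2)[OF pb2 a0 _ N0]) (use True in auto)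
    finally have m: "ln 2 / (real N * (2 * b')) \<le> real_of_int (m_in n N eps)" .
    have "1/4 * Q / real N ^ 3 \<le> (1/2) / (real N * (2 * (real N / Q)))"
    proof -
      have "1/4 * Q / real N ^ 3 \<le> 1/4 * Q / (real N)\<^sup>2"
        using N Q by (intro divide_left_mono power_increasing) auto
      then show ?thesis by (simp add: power2_eq_square)
    qed
    also have "\<dots> \<le> ln 2 / (real N * (2 * b'))"
      \<comment> \<open>The instance at 1/2 gives \<open>ln 2 \<ge> 1/2\<close>.\<close>
      using ln_le_minus_one[of "1/2 :: real"] N Q b'0 by (intro frac_le mult_left_mono mult_pos_pos) (auto simp: b'_def divide_right_mono ln_div)
    finally show "1/4 * Q / real N ^ 3 \<le> real_of_int (m_in n N eps)" using m by simp
  next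
    case False
    then have "Q \<le> 2 * real N" using Q by (simp add: b'_def field_simps)
    then have "1/4 * Q \<le> real N ^ 1" by simp
    also have "\<dots> \<le> real N ^ 3" using N by (intro power_increasing) auto
    finally have "1/4 * Q / real N ^ 3 \<le> 1" using N by simp
    then show "1/4 * Q / real N ^ 3 \<le> real_of_int (m_in n N eps)" using m1(1) by simp
  qed
  have L: "ln 2 / (real N * a) \<le> 2 * (Q / \<delta>) / (real N)\<^sup>2"
  proof -
    have "ln 2 / (real N * a) \<le> 1 / (real N * (real N / 2 * \<delta> / Q))"
    proof (intro frac_le mult_left_mono mult_pos_pos)
      show "ln 2 \<le> (1::real)" using ln_2_less_1 by simp
      show "real N / 2 * \<delta> / Q \<le> a"
        unfolding a using N \<delta> Q by (intro divide_right_mono mult_right_mono) auto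
    qed (use N \<delta> Q in auto)
    then show ?thesis by (simp add: power2_eq_square mult_ac)
  qed
  \<comment> \<open>This absorbs the 1 from rounding up:
    \<open>(2 + T)\<^sup>2 \<le> 8 + 2 * T\<^sup>2\<close> and \<open>8 + 2 * 841 = 1690\<close>,
    with \<open>1 \<le> Q\<close> and \<open>\<delta> \<le> 1\<close>.\<close>
  have one: "1 \<le> 1690 * (Q / \<delta>) / (real N)\<^sup>2"
  proof -
    have "(real N)\<^sup>2 \<le> (2 + T)\<^sup>2" using NT by (intro power_mono) auto
    also have "\<dots> \<le> 8 + 2 * T\<^sup>2"
      using zero_le_power2[of "T - 2"] by (simp add: power2_eq_square algebra_simps)
    also have "\<dots> \<le> 8 * Q + 2 * (841 * Q)"
    proof -
      have "1 \<le> Q" using powr_bin_entropy_le_2_power[OF eps_pos eps_less] entvol_pos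
        by (simp add: Q_def entvol_def x_def)
      moreover have "T\<^sup>2 \<le> 841 * Q"
        using T_sq_mult_entropy_le entvol_pos by (simp add: Q_def entvol_def[symmetric] pos_le_divide_eq)
      ultimately show ?thesis by linarith
    qed
    also have "\<dots> = 1690 * Q" by simp
    also have "\<dots> \<le> 1690 * (Q / \<delta>)"
      using Q \<delta> \<delta>1 by (simp add: pos_le_divide_eq)
    finally show ?thesis using N by (subst pos_le_divide_eq) auto
  qed
  have "real_of_int (m_in n N eps) \<le> ln 2 / (real N * a) + 1"
    by (rule m1(3))
  also have "\<dots> \<le> 2 * (Q / \<delta>) / (real N)\<^sup>2 + 1690 * (Q / \<delta>) / (real N)\<^sup>2"
    by (rule add_mono[OF L one])
  also have "\<dots> \<le> 2000 * (Q / \<delta>) / (real N)\<^sup>2"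
    using Q \<delta> unfolding add_divide_distrib[symmetric] by (auto intro!: divide_right_mono)
  finally show "real_of_int (m_in n N eps) \<le> 2000 * (2 ^ n / entvol / \<delta>) / (real N)\<^sup>2"
    unfolding Q_def .
qed

end

text \<open>The asymptotic bounds are read with absolute constants, uniform in \<open>n\<close>,
  \<open>N\<close>, \<open>eps\<close> and \<open>\<alpha>\<close>; 1/4 and 2000 serve.\<close>

theorem theorem4p11:
  "\<exists>c>0. \<exists>C>0. \<forall>(n::nat) (N::nat) (eps::nat) (\<alpha>::real).
     n \<ge> 2 \<longrightarrow> N \<ge> 2 \<longrightarrow> eps \<ge> 1 \<longrightarrow> real eps / real n \<le> 1/2 \<longrightarrow>
     \<alpha> < bin_entropy (real eps / real n) \<longrightarrow>
     real N \<le> 2 + 2 powr (- real eps)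
        * ((1 - real eps / real n) / (real eps / real n)) ^ nat \<lceil>(real eps + 1) / 2\<rceil>
        * (1 / sqrt (8 * real eps * (1 - real eps / real n)) - 2 powr (- real n * \<alpha>)) \<longrightarrow>
     c * 2 powr (real n * (1 - bin_entropy (real eps / real n)) - 3 * log 2 (real N))
        \<le> real_of_int (m_in n N eps)
     \<and> real_of_int (m_in n N eps)
        \<le> C * 2 powr (real n * (1 - bin_entropy (real eps / real n) + \<alpha>) - 2 * log 2 (real N))"
proof -
  have "1/4 * 2 powr (real n * (1 - bin_entropy (real eps / real n)) - 3 * log 2 (real N))
        \<le> real_of_int (m_in n N eps)
     \<and> real_of_int (m_in n N eps)
        \<le> 2000 * 2 powr (real n * (1 - bin_entropy (real eps / real n) + \<alpha>) - 2 * log 2 (real N))"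
    if N: "N \<ge> 2" and eps: "eps \<ge> 1" "real eps / real n \<le> 1/2" and n: "n \<ge> 2"
      and hyp: "real N \<le> 2 + 2 powr (- real eps)
        * ((1 - real eps / real n) / (real eps / real n)) ^ nat \<lceil>(real eps + 1) / 2\<rceil>
        * (1 / sqrt (8 * real eps * (1 - real eps / real n)) - 2 powr (- real n * \<alpha>))"
    for n N eps :: nat and \<alpha> :: real
  proof -
    have "real (2 * eps) \<le> real n" using eps(2) n by (simp add: field_simps)
    then have "2 * eps \<le> n" by (simp only: of_nat_le_iff)
    then interpret template_params n eps "real eps / real n"
      "(1 - real eps / real n) / (real eps / real n)"
      "1 / sqrt (8 * real eps * (1 - real eps / real n))"
      "((1 - real eps / real n) / (real eps / real n)) ^ ((eps + 2) div 2) / 2 ^ eps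
        * (1 / sqrt (8 * real eps * (1 - real eps / real n)))"
      by unfold_locales (use eps in auto)
    define \<delta> where "\<delta> = 2 powr (- real n * \<alpha>)"
    have "2 powr (- real eps) = 1 / (2 :: real) ^ eps"
      by (simp add: powr_minus powr_realpow divide_inverse)
    then have hyp': "real N \<le> 2 + ((1 - real eps / real n) / (real eps / real n)) ^ ((eps + 2) div 2) / 2 ^ eps
        * (1 / sqrt (8 * real eps * (1 - real eps / real n)) - \<delta>)"
      using hyp by (simp add: nat_ceiling_half \<delta>_def mult_ac)
    have \<delta>0: "0 < \<delta>" by (simp add: \<delta>_def)
    have lg: "2 powr (real k * log 2 (real N)) = real N ^ k" for k :: nat
      using N by (simp add: powr_realpow powr_powr[symmetric] mult.commute[of "real k"])
    have Q: "2 powr (real n * (1 - bin_entropy (real eps / real n))) = 2 ^ n / entvol"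
      by (simp add: entvol_def right_diff_distrib powr_diff powr_realpow)
    have "2 powr (real n * (1 - bin_entropy (real eps / real n)) - 3 * log 2 (real N))
        = 2 ^ n / entvol / real N ^ 3"
      unfolding powr_diff Q using lg[of 3] by simp
    moreover have "2 powr (real n * (1 - bin_entropy (real eps / real n) + \<alpha>) - 2 * log 2 (real N))
        = 2 ^ n / entvol / \<delta> / (real N)\<^sup>2"
    proof -
      have "2 powr (real n * (1 - bin_entropy (real eps / real n) + \<alpha>)) = 2 ^ n / entvol / \<delta>"
        unfolding distrib_left powr_add Q by (simp add: \<delta>_def powr_minus divide_inverse)
      then show ?thesis unfolding powr_diff using lg[of 2] by simp
    qed
    ultimately show ?thesis
      using m_in_asymptotics[OF N hyp' \<delta>0] by simp
  qed
  then show ?thesis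
    by (intro exI[of _ "1/4 :: real"] exI[of _ "2000 :: real"] conjI allI impI) auto
qed

end
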